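(* Let $m\ge1$ and let $\lambda=(\lambda_1,\dots,\lambda_m)$ be a partition with at most $m$ parts. Then the dual Grothendieck polynomial $g_\lambda(x_1,\dots,x_m)$ has saturated Newton polytope (SNP), and $Newton(g_\lambda)$ has the integer decomposition property (IDP).
   Context: **Polytopes.** A lattice polytope in $\mathbb{R}^m$ is the convex hull of finitely many points whose vertices lie in $\mathbb{Z}^m$. For a positive integer $t$, $t\mathcal{P}=\{tv \mid v\in\mathcal{P}\}$. A lattice polytope $\mathcal{P}$ has the integer decomposition property (IDP) if for every positive integer $t$ and every $p\in t\mathcal{P}\cap\mathbb{Z}^m$ there are $t$ points $v_1,\dots,v_t\in\mathcal{P}\cap\mathbb{Z}^m$ (not necessarily distinct) with $p=v_1+\dots+v_t$. **Newton polytopes.** For $f=\sum_{\alpha\in\mathbb{Z}_{\ge 0}^m}c_\alpha x^\alpha\in\mathbb{C}[x_1,\dots,x_m]$, let $Supp(f)=\{\alpha\in\mathbb{Z}_{\ge0}^m \mid c_\alpha\neq 0\}$ and let $Newton(f)=Conv(Supp(f))$ be its convex hull in $\mathbb{R}^m$. The polynomial $f$ has saturated Newton polytope (SNP) if $Newton(f)\cap\mathbb{Z}^m=Supp(f)$. **Partitions and Schur polynomials.** A partition with at most $m$ parts is a weakly decreasing sequence $\lambda=(\lambda_1,\dots,\lambda_m)$ of nonnegative integers, identified with its Young diagram, which has $\lambda_i$ boxes, left-justified, in the $i$-th row from the top. The Schur polynomial $s_\lambda(x_1,\dots,x_m)$ is the sum of $x^T=x_1^{\alpha_1}\cdots x_m^{\alpha_m}$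 over all semistandard Young tableaux $T$ of shape $\lambda$ with entries in $\{1,\dots,m\}$ (rows weakly increasing, columns strictly increasing from top to bottom), where $\alpha_i$ is the number of entries $i$ in $T$. **Dual Grothendieck polynomials.** For a partition $\lambda$ with at most $m$ parts, $$g_\lambda(x_1,\dots,x_m)=\sum_{\mu} f_\lambda^\mu\, s_\mu(x_1,\dots,x_m),$$ where the sum is over partitions $\mu$ contained in $\lambda$ (that is, $\mu_i\le\lambda_i$ for all $i$) and $f_\lambda^\mu$ is the number of semistandard tableaux of skew shape $\lambda/\mu$ (rows weakly increasing, columns strictly increasing from top to bottom) whose entries in the $i$-th row (row index in $\lambda$) lie in $\{1,\dots,i-1\}$ for every $i$. In particular, no box of $\lambda/\mu$ may lie in the first row, and for $\mu=\lambda$ the empty filling gives $f_\lambda^\lambda=1$. *)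

theory Defs
  imports "HOL-Analysis.Analysis" "HOL-Library.Poly_Mapping" "HOL-Library.FuncSet"
begin

text \<open>The index type \<open>'m :: {finite, linorder}\<close> is a finite chain and plays the role of
  \<open>{1 < 2 < \<dots> < m}\<close> with \<open>m = CARD('m)\<close>: it indexes the variables and the coordinates
  of real space, and it supplies the entries of the tableaux in Schur polynomials.\<close>

subsection \<open>Polytopes\<close>

definition lattice_points :: "(real ^ 'm::finite) set" where
  "lattice_points = {v. \<forall>i. v $ i \<in> \<int>}"

definition lattice_polytope :: "(real ^ 'm::finite) set \<Rightarrow> bool" where
  "lattice_polytope P \<longleftrightarrow> polytope P \<and> (\<forall>v. v extreme_point_of P \<longrightarrow> v \<in> lattice_points)"

definition has_IDP :: "(real ^ 'm::finite) set \<Rightarrow> bool" where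
  "has_IDP P \<longleftrightarrow> lattice_polytope P \<and>
     (\<forall>t\<ge>1. \<forall>p \<in> (\<lambda>v. real t *\<^sub>R v) ` P \<inter> lattice_points.
        \<exists>v :: nat \<Rightarrow> real ^ 'm.
          (\<forall>k\<in>{1..t}. v k \<in> P \<inter> lattice_points) \<and> p = (\<Sum>k=1..t. v k))"

subsection \<open>Newton polytopes\<close>

type_synonym 'm cpoly = "('m \<Rightarrow>\<^sub>0 nat) \<Rightarrow>\<^sub>0 complex"

definition var :: "'m \<Rightarrow> 'm cpoly" where
  "var i = Poly_Mapping.single (Poly_Mapping.single i 1) 1"

definition exponent_vector :: "('m::finite \<Rightarrow>\<^sub>0 nat) \<Rightarrow> real ^ 'm" where
  "exponent_vector \<alpha> = (\<chi> i. real (Poly_Mapping.lookup \<alpha> i))"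

definition Supp :: "'m::finite cpoly \<Rightarrow> (real ^ 'm) set" where
  "Supp f = exponent_vector ` Poly_Mapping.keys f"

definition Newton :: "'m::finite cpoly \<Rightarrow> (real ^ 'm) set" where
  "Newton f = convex hull (Supp f)"

definition has_SNP :: "'m::finite cpoly \<Rightarrow> bool" where
  "has_SNP f \<longleftrightarrow> Newton f \<inter> lattice_points = Supp f"

subsection \<open>Partitions and tableaux\<close>

text \<open>Parts are \<open>\<lambda> 1, \<dots>, \<lambda> m\<close>. Requiring the value 0 at all other indices (including 0)
  makes the representing function unique, so that sums over partitions are well defined.\<close>

definition partition_le :: "nat \<Rightarrow> (nat \<Rightarrow> nat) \<Rightarrow> bool" where
  "partition_le m lam \<longleftrightarrow>
     (\<forall>i j. 1 \<le> i \<and> i \<le> j \<and> j \<le> m \<longrightarrow> lam j \<le> lam i) \<and> (\<forall>i. i \<notin> {1..m} \<longrightarrow> lam i = 0)"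

text \<open>Boxes are (row, column), both counted from 1.\<close>

definition skew_diagram :: "(nat \<Rightarrow> nat) \<Rightarrow> (nat \<Rightarrow> nat) \<Rightarrow> (nat \<times> nat) set" where
  "skew_diagram lam mu = {(i, j). mu i < j \<and> j \<le> lam i}"

abbreviation diagram :: "(nat \<Rightarrow> nat) \<Rightarrow> (nat \<times> nat) set" where
  "diagram lam \<equiv> skew_diagram lam (\<lambda>_. 0)"

text \<open>Tableaux are \<open>undefined\<close> outside their diagram, so distinct functions are distinct fillings.\<close>

definition ssyt :: "(nat \<times> nat) set \<Rightarrow> (nat \<times> nat \<Rightarrow> 'e::linorder) \<Rightarrow> bool" where
  "ssyt D T \<longleftrightarrow> T \<in> extensional D \<and>
     (\<forall>i j j'. (i, j) \<in> D \<and> (i, j') \<in> D \<and> j < j' \<longrightarrow> T (i, j) \<le> T (i, j')) \<and>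
     (\<forall>i i' j. (i, j) \<in> D \<and> (i', j) \<in> D \<and> i < i' \<longrightarrow> T (i, j) < T (i', j))"

subsection \<open>Schur and dual Grothendieck polynomials\<close>

definition tableau_monomial :: "(nat \<times> nat) set \<Rightarrow> (nat \<times> nat \<Rightarrow> 'm::finite) \<Rightarrow> 'm cpoly" where
  "tableau_monomial D T = (\<Prod>k\<in>UNIV. var k ^ card {b \<in> D. T b = k})"

definition schur :: "(nat \<Rightarrow> nat) \<Rightarrow> 'm::{finite, linorder} cpoly" where
  "schur lam = (\<Sum>T | ssyt (diagram lam) T. tableau_monomial (diagram lam) T)"

definition elegant_count :: "(nat \<Rightarrow> nat) \<Rightarrow> (nat \<Rightarrow> nat) \<Rightarrow> nat" where
  "elegant_count lam mu =
     card {E :: nat \<times> nat \<Rightarrow> nat. ssyt (skew_diagram lam mu) E \<and>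
             (\<forall>(i, j) \<in> skew_diagram lam mu. E (i, j) \<in> {1..i - 1})}"

definition dual_grothendieck :: "(nat \<Rightarrow> nat) \<Rightarrow> 'm::{finite, linorder} cpoly" where
  "dual_grothendieck lam =
     (\<Sum>mu | partition_le CARD('m) mu \<and> (\<forall>i. mu i \<le> lam i).
        of_nat (elegant_count lam mu) * schur mu)"

text \<open>Sums over infinite sets and cardinalities of infinite sets would silently be 0; the
  following facts rule this out, and \<open>elegant_count_self\<close> checks the empty filling.\<close>

lemma finite_diagram:
  assumes "partition_le m lam"
  shows "finite (skew_diagram lam mu)"
proof -
  have "skew_diagram lam mu \<subseteq> (SIGMA i:{1..m}. {..lam i})"
    using assms by (force simp: skew_diagram_def partition_le_def)
  then show ?thesis
    by (rule finite_subset) auto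
qed

lemma finite_tableaux:
  assumes "finite D" "finite A"
  shows "finite {T. ssyt D T \<and> (\<forall>b\<in>D. T b \<in> A)}"
proof -
  have "{T. ssyt D T \<and> (\<forall>b\<in>D. T b \<in> A)} \<subseteq> PiE D (\<lambda>_. A)"
    by (auto simp: ssyt_def PiE_def)
  then show ?thesis
    using assms by (meson finite_PiE finite_subset)
qed

lemma finite_schur_index:
  assumes "partition_le m lam"
  shows "finite {T :: nat \<times> nat \<Rightarrow> 'm::{finite, linorder}. ssyt (diagram lam) T}"
  using finite_tableaux[OF finite_diagram[OF assms], of "UNIV :: 'm set"] by simp

lemma finite_elegant:
  assumes "partition_le m lam"
  shows "finite {E :: nat \<times> nat \<Rightarrow> nat. ssyt (skew_diagram lam mu) E \<and>
             (\<forall>(i, j) \<in> skew_diagram lam mu. E (i, j) \<in> {1..i - 1})}"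
proof -
  have "E b \<le> m" if "b \<in> skew_diagram lam mu"
    and "\<forall>(i, j) \<in> skew_diagram lam mu. E (i, j) \<in> {1..i - 1}" for E :: "nat \<times> nat \<Rightarrow> nat" and b
  proof -
    obtain i j where b: "b = (i, j)" by force
    have "i \<le> m" using that(1) assms unfolding b
      by (force simp: skew_diagram_def partition_le_def)
    with that show ?thesis unfolding b by force
  qed
  then show ?thesis
    by (intro finite_subset[OF _ finite_tableaux[OF finite_diagram[OF assms, of mu], of "{..m}"]]) auto
qed

lemma finite_subpartitions:
  assumes "partition_le m lam"
  shows "finite {mu. partition_le m mu \<and> (\<forall>i. mu i \<le> lam i)}"
proof -
  have "{mu. partition_le m mu \<and> (\<forall>i. mu i \<le> lam i)}
          \<subseteq> {f. \<forall>i. (i \<in> {1..m} \<longrightarrow> f i \<in> {..Max (lam ` {1..m})}) \<and> (i \<notin> {1..m} \<longrightarrow> f i = 0)}"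
    by (auto simp: partition_le_def intro: order_trans[OF _ Max_ge])
  then show ?thesis
    by (rule finite_subset) (rule finite_set_of_finite_funs, auto)
qed

lemma elegant_count_self: "elegant_count lam lam = 1"
proof -
  have "skew_diagram lam lam = {}"
    by (auto simp: skew_diagram_def)
  then show ?thesis
    by (simp add: elegant_count_def ssyt_def)
qed

end

theory Submission
  imports Defs
begin

text \<open>Everything follows from one description of the support. Write \<open>F k\<close> for the sum of the first
  \<open>k\<close> parts of \<open>\<lambda>\<close>, which is \<open>top_rows \<lambda> k\<close> below. The exponents occurring in \<open>g\<^sub>\<lambda>\<close> are exactly
  the lattice points of the polyhedron
  \<open>P(\<lambda>) = {x. x \<ge> 0, x(S) \<le> F(card S) for every set S of variables, \<lambda>\<^sub>1 \<le> x(all variables)}\<close>,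
  called \<open>gpolymatroid\<close> below (lemma \<open>Supp_dual_grothendieck_eq_lattice_points\<close>).

  The coefficients are nonnegative, so there is no cancellation, and an exponent occurs iff it is
  the content of a semistandard tableau of some shape \<open>\<mu> \<subseteq> \<lambda>\<close> for which \<open>\<lambda>/\<mu>\<close> has an elegant
  filling. Such a filling exists iff \<open>\<mu>\<^sub>1 = \<lambda>\<^sub>1\<close> (lemma \<open>elegant_count_pos_iff\<close>).
  A content \<open>c\<close> of a tableau of shape \<open>\<mu>\<close> satisfies \<open>c(S) \<le> \<mu>\<^sub>1 + \<dots> + \<mu>\<^bsub>card S\<^esub>\<close>, because the
  entries from \<open>S\<close> in one column are distinct (lemma \<open>content_sum_le_top_rows\<close>); conversely these
  inequalities, with equality for the set of all variables, suffice for a tableau to exist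
  (lemma \<open>ssyt_with_content\<close>). Finally, among the admissible \<open>\<mu>\<close> of a given size there is a
  dominant one, obtained by filling \<open>\<lambda>\<close> row by row from the top, and for it the inequalities of
  \<open>\<mu>\<close> say no more than those of \<open>\<lambda>\<close>.

  Saturation is then immediate: \<open>P(\<lambda>)\<close> is convex, so it contains the Newton polytope, whose lattice
  points therefore already lie in the support.

  For the integer decomposition property, a lattice point of the \<open>t\<close>-th dilate lies in
  \<open>t P(\<lambda>) \<subseteq> P(t\<lambda>)\<close>, hence is the content of a tableau of some shape \<open>\<nu> \<subseteq> t\<lambda>\<close> with
  \<open>\<nu>\<^sub>1 = t\<lambda>\<^sub>1\<close>. Dealing out the columns of this tableau cyclically to \<open>t\<close> players leaves each of
  them with a semistandard tableau whose shape is contained in \<open>\<lambda>\<close> and has first row exactly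
  \<open>\<lambda>\<^sub>1\<close>; its content is a point of the support of \<open>g\<^sub>\<lambda>\<close>, and the \<open>t\<close> contents add up to the
  given point (lemma \<open>lattice_point_decomposition\<close>).\<close>

section \<open>Tableaux and their contents\<close>

definition tableau_content :: "(nat \<times> nat) set \<Rightarrow> (nat \<times> nat \<Rightarrow> 'e) \<Rightarrow> 'e \<Rightarrow> nat" where
  "tableau_content D T k = card {b \<in> D. T b = k}"

definition top_rows :: "(nat \<Rightarrow> nat) \<Rightarrow> nat \<Rightarrow> nat" where
  "top_rows mu k = (\<Sum>i=1..k. mu i)"

lemma top_rows_0 [simp]: "top_rows mu 0 = 0"
  by (simp add: top_rows_def)

lemma top_rows_Suc [simp]: "top_rows mu (Suc k) = top_rows mu k + mu (Suc k)"
  by (simp add: top_rows_def)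

lemma top_rows_mono: "k \<le> l \<Longrightarrow> top_rows mu k \<le> top_rows mu l"
  unfolding top_rows_def by (rule sum_mono2) auto

lemma top_rows_le: "(\<And>i. mu i \<le> lam i) \<Longrightarrow> top_rows mu k \<le> top_rows lam k"
  unfolding top_rows_def by (rule sum_mono)

lemma partition_le_antimono:
  assumes "partition_le n mu" "1 \<le> i" "i \<le> j"
  shows "mu j \<le> mu i"
proof (cases "j \<le> n")
  case False
  then have "mu j = 0" using assms by (simp add: partition_le_def)
  then show ?thesis by simp
qed (use assms in \<open>simp add: partition_le_def\<close>)

lemma partition_le_outside:
  assumes "partition_le n mu" "i = 0 \<or> n < i"
  shows "mu i = 0"
  using assms by (auto simp: partition_le_def)

lemma mem_diagram: "(i, j) \<in> diagram mu \<longleftrightarrow> 1 \<le> j \<and> j \<le> mu i"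
  by (auto simp: skew_diagram_def)

lemma mem_diagram_row:
  assumes "partition_le n mu" "(i, j) \<in> diagram mu"
  shows "1 \<le> i" "i \<le> n"
  using assms partition_le_outside[OF assms(1), of i]
  by (auto simp: mem_diagram not_less_eq_eq Suc_le_eq intro: ccontr)

lemma diagram_eq_Sigma:
  assumes "partition_le n mu"
  shows "diagram mu = (SIGMA i:{1..n}. {1..mu i})"
  using mem_diagram_row[OF assms] by (auto simp: mem_diagram)

lemma card_diagram:
  assumes "partition_le n mu"
  shows "card (diagram mu) = top_rows mu n"
  unfolding diagram_eq_Sigma[OF assms] by (simp add: top_rows_def)

lemma sum_content:
  assumes "finite D" "finite S"
  shows "(\<Sum>k\<in>S. tableau_content D T k) = card {b \<in> D. T b \<in> S}"
proof -
  have "{b \<in> D. T b \<in> S} = (\<Union>k\<in>S. {b \<in> D. T b = k})" by auto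
  also have "card \<dots> = (\<Sum>k\<in>S. card {b \<in> D. T b = k})"
    using assms by (intro card_UN_disjoint) auto
  finally show ?thesis by (simp add: tableau_content_def)
qed

text \<open>The boxes are counted column by column. In column \<open>j\<close> the boxes with entries in \<open>S\<close>
  number at most \<open>card S\<close>, since columns increase strictly, and at most the height of the column.
  The smaller of these two bounds is the number of rows \<open>i \<le> card S\<close> that reach column \<open>j\<close>, and
  adding this up over \<open>j\<close> counts the boxes of the first \<open>card S\<close> rows.\<close>

lemma content_sum_le_top_rows:
  fixes T :: "nat \<times> nat \<Rightarrow> 'e::linorder"
  assumes mu: "partition_le n mu" and T: "ssyt (diagram mu) T" and S: "finite S"
  shows "(\<Sum>k\<in>S. tableau_content (diagram mu) T k) \<le> top_rows mu (card S)"
proof -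
  define C where "C j = {i. (i, j) \<in> diagram mu \<and> T (i, j) \<in> S}" for j
  define R where "R j = {i \<in> {1..card S}. j \<le> mu i}" for j
  have C_sub: "C j \<subseteq> {1..n}" for j
    using mem_diagram_row[OF mu] by (auto simp: C_def)
  then have finC: "finite (C j)" for j by (rule finite_subset) simp
  have lt: "T (i, j) < T (i', j)" if "i \<in> C j" "i' \<in> C j" "i < i'" for i i' j
    using T that by (simp add: ssyt_def C_def)
  have inj: "inj_on (\<lambda>i. T (i, j)) (C j)" for j
    by (rule linorder_inj_onI) (auto dest: lt)
  have col: "card (C j) \<le> card (R j)" for j
  proof (cases "\<forall>i\<in>{1..card S}. j \<le> mu i")
    case True
    then have "R j = {1..card S}" by (auto simp: R_def)
    moreover have "card (C j) \<le> card S"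
      using inj S by (intro card_inj_on_le[of "\<lambda>i. T (i, j)"]) (auto simp: C_def)
    ultimately show ?thesis by simp
  next
    case False
    then obtain i0 where i0: "1 \<le> i0" "i0 \<le> card S" "mu i0 < j" by auto
    \<comment> \<open>Row \<open>i0\<close> does not reach column \<open>j\<close>, so the whole column lies above it.\<close>
    have "C j \<subseteq> R j"
    proof
      fix i assume i: "i \<in> C j"
      then have "1 \<le> i" using C_sub by fastforce
      moreover have "j \<le> mu i" using i by (simp add: C_def mem_diagram)
      moreover from this have "i < i0"
        using partition_le_antimono[OF mu i0(1), of i] i0(3) by linarith
      ultimately show "i \<in> R j" using i0 by (auto simp: R_def)
    qed
    then show ?thesis by (intro card_mono) (auto simp: R_def)
  qed
  have bnd: "j \<le> mu 1" if "1 \<le> i" "j \<le> mu i" for i j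
    using partition_le_antimono[OF mu _ that(1)] that by simp
  have box: "j \<in> {1..mu 1}" if "(i, j) \<in> diagram mu" for i j
    using bnd[of i j] mem_diagram_row(1)[OF mu that] that by (simp add: mem_diagram)
  have "(\<Sum>k\<in>S. tableau_content (diagram mu) T k) = card {b \<in> diagram mu. T b \<in> S}"
    using finite_diagram[OF mu] S by (rule sum_content)
  also have "\<dots> = card (SIGMA j:{1..mu 1}. C j)"
    by (intro bij_betw_same_card[of "\<lambda>(i, j). (j, i)"] bij_betw_byWitness[of _ "\<lambda>(i, j). (j, i)"])
      (auto simp: C_def dest: box simp del: atLeastAtMost_iff)
  also have "\<dots> = (\<Sum>j\<in>{1..mu 1}. card (C j))" using finC by simp
  also have "\<dots> \<le> (\<Sum>j\<in>{1..mu 1}. card (R j))" by (intro sum_mono col)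
  also have "\<dots> = card (SIGMA j:{1..mu 1}. R j)" by (simp add: R_def)
  also have "\<dots> = card (SIGMA i:{1..card S}. {1..mu i})"
    by (intro bij_betw_same_card[of "\<lambda>(i, j). (j, i)"] bij_betw_byWitness[of _ "\<lambda>(i, j). (j, i)"])
      (auto simp: R_def intro: bnd[unfolded One_nat_def])
  also have "\<dots> = top_rows mu (card S)" by (simp add: top_rows_def)
  finally show ?thesis .
qed

section \<open>Existence of tableaux with prescribed content\<close>

text \<open>What is left of \<open>mu\<close> after removing a horizontal strip of \<open>a\<close> boxes as low down as possible:
  from the bottom row upwards, row \<open>i\<close> gives up boxes until its length is \<open>mu (i + 1)\<close> or the \<open>a\<close>
  boxes are used up. The rows below row \<open>i\<close> can supply at most \<open>mu (i + 1)\<close> boxes in all, so row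
  \<open>i\<close> keeps its length if \<open>a \<le> mu (i + 1)\<close>, shrinks to \<open>mu (i + 1)\<close> if \<open>a \<ge> mu i\<close>, and loses
  \<open>a - mu (i + 1)\<close> boxes in between. Row 0 carries no boxes and has to be kept empty.\<close>

definition strip_rest :: "nat \<Rightarrow> (nat \<Rightarrow> nat) \<Rightarrow> nat \<Rightarrow> nat" where
  "strip_rest a mu i =
     (if i = 0 then 0 else mu i + mu (Suc i) - min (mu i) (max (mu (Suc i)) a))"

lemma strip_rest_interlaces:
  assumes "partition_le n mu" "1 \<le> i"
  shows "mu (Suc i) \<le> strip_rest a mu i" "strip_rest a mu i \<le> mu i"
  using assms partition_le_antimono[OF assms, of "Suc i"] by (auto simp: strip_rest_def)

lemma partition_le_strip_rest:
  assumes mu: "partition_le n mu"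
  shows "partition_le n (strip_rest a mu)"
proof -
  have "strip_rest a mu j \<le> strip_rest a mu i" if "1 \<le> i" "i \<le> j" for i j
  proof (cases "i = j")
    case False
    then have "strip_rest a mu j \<le> mu j" "mu j \<le> mu (Suc i)" "mu (Suc i) \<le> strip_rest a mu i"
      using that strip_rest_interlaces[OF mu] partition_le_antimono[OF mu] by auto
    then show ?thesis by simp
  qed simp
  moreover have "strip_rest a mu i = 0" if "i \<notin> {1..n}" for i
    using that mu by (auto simp: strip_rest_def partition_le_outside)
  ultimately show ?thesis by (simp add: partition_le_def)
qed

text \<open>This is the formula that makes the induction over the entries work. If \<open>a\<close> is the
  multiplicity of the largest entry \<open>e\<close>, then the two terms of the minimum are exactly the bounds
  on \<open>c(S)\<close> that come from the inequalities for \<open>S\<close> and for \<open>S \<union> {e}\<close>.\<close>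

lemma top_rows_strip_rest:
  assumes mu: "partition_le n mu" and a: "a \<le> mu 1"
  shows "top_rows (strip_rest a mu) k = min (top_rows mu k) (top_rows mu (Suc k) - a)"
proof (induction k)
  case 0
  then show ?case using a by simp
next
  case (Suc k)
  have "mu (Suc (Suc k)) \<le> mu (Suc k)"
    using partition_le_antimono[OF mu, of "Suc k" "Suc (Suc k)"] by simp
  moreover have "a \<le> top_rows mu (Suc k)"
    using a top_rows_mono[of 1 "Suc k" mu] by simp
  ultimately show ?case using Suc by (auto simp: strip_rest_def min_def max_def)
qed

lemma ssyt_extend_strip:
  fixes T :: "nat \<times> nat \<Rightarrow> 'e::linorder"
  assumes mu: "partition_le n mu"
    and T: "ssyt (diagram nu) T" and less: "\<And>b. b \<in> diagram nu \<Longrightarrow> T b < e"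
    and le: "\<And>i. nu i \<le> mu i" and strip: "\<And>i. 1 \<le> i \<Longrightarrow> mu (Suc i) \<le> nu i"
  shows "ssyt (diagram mu)
           (restrict (\<lambda>b. if b \<in> diagram nu then T b else e) (diagram mu))"
proof -
  have col: "(i, j) \<in> diagram nu" if "(i, j) \<in> diagram mu" "(i', j) \<in> diagram mu" "i < i'" for i i' j
  proof -
    have "1 \<le> i" using mem_diagram_row[OF mu that(1)] by simp
    then have "mu i' \<le> nu i"
      using strip[of i] partition_le_antimono[OF mu, of "Suc i" i'] that(3) by fastforce
    then show ?thesis using that by (auto simp: mem_diagram)
  qed
  have row: "(i, j) \<in> diagram nu" if "(i, j) \<in> diagram mu" "(i, j') \<in> diagram nu" "j < j'" for i j j'
    using that by (auto simp: mem_diagram)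
  show ?thesis
    using T less col row unfolding ssyt_def by (auto simp: less_imp_le)
qed

text \<open>Positivity of Kostka numbers, for a content that need not be sorted. The boxes
  holding the largest entry \<open>e\<close> of a tableau form a horizontal strip; removing this strip as low as
  possible leaves the largest remaining shape in dominance order, which satisfies the inequalities
  for the remaining entries, so that they can be placed by induction.\<close>

lemma ssyt_with_content:
  fixes A :: "'e::linorder set"
  assumes "finite A" "partition_le n mu" "(\<Sum>k\<in>A. c k) = top_rows mu n"
    and "\<And>S. S \<subseteq> A \<Longrightarrow> (\<Sum>k\<in>S. c k) \<le> top_rows mu (card S)"
  shows "\<exists>T. ssyt (diagram mu) T \<and> (\<forall>b\<in>diagram mu. T b \<in> A) \<and>
             (\<forall>k\<in>A. tableau_content (diagram mu) T k = c k)"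
  using assms
proof (induction A arbitrary: mu rule: finite_linorder_max_induct)
  case empty
  then have "mu i = 0" for i
    using partition_le_outside[OF empty(1), of i] by (cases "i \<in> {1..n}") (auto simp: top_rows_def)
  then have "diagram mu = {}" by (auto simp: mem_diagram skew_diagram_def)
  then show ?case by (auto simp: ssyt_def)
next
  case (insert e A)
  note mu = insert.prems(1)
  define nu where "nu = strip_rest (c e) mu"
  have e: "e \<notin> A" using insert.hyps(2) by auto
  have "c e \<le> mu 1" using insert.prems(3)[of "{e}"] by (simp add: top_rows_def)
  note top = top_rows_strip_rest[OF mu this, folded nu_def]
  have nu: "partition_le n nu" using partition_le_strip_rest[OF mu] by (simp add: nu_def)
  have le: "nu i \<le> mu i" for i
    using strip_rest_interlaces[OF mu, of i] by (cases "i = 0") (auto simp: nu_def strip_rest_def)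
  have strip: "mu (Suc i) \<le> nu i" if "1 \<le> i" for i
    using strip_rest_interlaces[OF mu that] by (simp add: nu_def)
  have total: "top_rows nu n + c e = top_rows mu n" "(\<Sum>k\<in>A. c k) = top_rows nu n"
    using top[of n] insert.prems(2) e insert.hyps(1) mu by (auto simp: partition_le_outside)
  have "(\<Sum>k\<in>S. c k) \<le> top_rows nu (card S)" if "S \<subseteq> A" for S
  proof -
    \<comment> \<open>The inequalities for \<open>S\<close> and for \<open>S \<union> {e}\<close> give the two bounds in the minimum \<open>top\<close>.\<close>
    have S: "finite S" "e \<notin> S" using that insert.hyps(1) e finite_subset by auto
    have "(\<Sum>k\<in>S. c k) \<le> top_rows mu (card S)" using insert.prems(3)[of S] that by auto
    moreover have "c e + (\<Sum>k\<in>S. c k) \<le> top_rows mu (Suc (card S))"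
      using insert.prems(3)[of "insert e S"] that S by auto
    ultimately show ?thesis unfolding top by simp
  qed
  from insert.IH[OF nu total(2) this] obtain T where
    T: "ssyt (diagram nu) T" "\<And>b. b \<in> diagram nu \<Longrightarrow> T b \<in> A"
      "\<And>k. k \<in> A \<Longrightarrow> tableau_content (diagram nu) T k = c k" by blast
  define T' where "T' = restrict (\<lambda>b. if b \<in> diagram nu then T b else e) (diagram mu)"
  have sub: "diagram nu \<subseteq> diagram mu"
    using le order_trans by (fastforce simp: skew_diagram_def)
  have "ssyt (diagram mu) T'"
    unfolding T'_def using T insert.hyps(2)
    by (intro ssyt_extend_strip[OF mu T(1) _ le strip]) auto
  moreover have "\<forall>b\<in>diagram mu. T' b \<in> insert e A" using T(2) by (simp add: T'_def)
  moreover have "tableau_content (diagram mu) T' k = c k" if "k \<in> A" for k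
  proof -
    have "{b \<in> diagram mu. T' b = k} = {b \<in> diagram nu. T b = k}"
      using sub that e by (auto simp: T'_def)
    then show ?thesis using T(3)[OF that] by (simp add: tableau_content_def)
  qed
  moreover have "tableau_content (diagram mu) T' e = c e"
  proof -
    have "{b \<in> diagram mu. T' b = e} = diagram mu - diagram nu"
      using sub T(2) e by (auto simp: T'_def)
    then have "tableau_content (diagram mu) T' e = top_rows mu n - top_rows nu n"
      using sub finite_diagram[OF nu]
      by (simp add: tableau_content_def card_Diff_subset card_diagram[OF mu] card_diagram[OF nu])
    then show ?thesis using total(1) by simp
  qed
  ultimately show ?case by blast
qed

section \<open>The support of a dual Grothendieck polynomial\<close>

text \<open>No entry is allowed in the first row, so \<open>mu\<close> and \<open>lam\<close> have to agree there. If they do,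
  let the entry of a box be its position, counted from the top, among the boxes of its column that
  lie outside \<open>mu\<close>. As row 1 lies in \<open>mu\<close>, this is at most \<open>i - 1\<close> in row \<open>i\<close>; and it
  increases weakly along rows because the columns of \<open>mu\<close> get shorter.\<close>

lemma elegant_count_pos_iff:
  assumes lam: "partition_le n lam" and le: "\<And>i. mu i \<le> lam i"
  shows "elegant_count lam mu \<noteq> 0 \<longleftrightarrow> mu 1 = lam 1"
  (is "?L \<longleftrightarrow> ?R")
proof -
  let ?D = "skew_diagram lam mu"
  have "?R" if "?L"
  proof -
    from that have "{E :: nat \<times> nat \<Rightarrow> nat. ssyt ?D E \<and> (\<forall>(i, j)\<in>?D. E (i, j) \<in> {1..i - 1})} \<noteq> {}"
      unfolding elegant_count_def by (intro notI) (simp only: card.empty)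
    then obtain E :: "nat \<times> nat \<Rightarrow> nat" where E: "\<forall>(i, j)\<in>?D. E (i, j) \<in> {1..i - 1}"
      by auto
    have "(1, lam 1) \<notin> ?D"
    proof
      assume "(1, lam 1) \<in> ?D"
      from bspec[OF E this] show False by auto
    qed
    then show ?thesis using le[of 1] by (auto simp: skew_diagram_def)
  qed
  moreover have "?L" if eq: "?R"
  proof -
    define c where "c i j = {r \<in> {1..i}. mu r < j}" for i j :: nat
    define E where "E = restrict (\<lambda>(i, j). card (c i j)) ?D"
    have pos: "1 \<le> i" if "(i, j) \<in> ?D" for i j
      using that partition_le_outside[OF lam, of i] by (cases i) (auto simp: skew_diagram_def)
    have "E (i, j) \<in> {1..i - 1}" if "(i, j) \<in> ?D" for i j
    proof -
      have "lam i \<le> mu 1" using partition_le_antimono[OF lam _ pos[OF that]] eq by simp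
      then have "1 \<notin> c i j" "i \<in> c i j"
        using that pos[OF that] by (auto simp: c_def skew_diagram_def)
      then have "{i} \<subseteq> c i j" "c i j \<subseteq> {1..i} - {1}" by (auto simp: c_def)
      then have "card {i} \<le> card (c i j)" "card (c i j) \<le> card ({1..i} - {1})"
        by (auto intro!: card_mono simp: c_def simp del: card.insert card_Diff_insert)
      moreover have "card ({1..i} - {1}) = i - 1" using pos[OF that] by simp
      ultimately have "1 \<le> card (c i j)" "card (c i j) \<le> i - 1" by simp_all
      then show ?thesis using that by (simp add: E_def)
    qed
    moreover have "ssyt ?D E"
    proof -
      have "card (c i j) \<le> card (c i j')" if "j < j'" for i j j'
        using that by (intro card_mono) (auto simp: c_def)
      moreover have "card (c i j) < card (c i' j)" if "(i', j) \<in> ?D" "i < i'" for i i' j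
      proof (rule psubset_card_mono)
        have "i' \<in> c i' j" "i' \<notin> c i j" "c i j \<subseteq> c i' j"
          using that pos[OF that(1)] by (auto simp: c_def skew_diagram_def)
        then show "c i j \<subset> c i' j" by blast
      qed (simp add: c_def)
      ultimately show ?thesis by (auto simp: ssyt_def E_def)
    qed
    ultimately have "E \<in> {E. ssyt ?D E \<and> (\<forall>(i, j)\<in>?D. E (i, j) \<in> {1..i - 1})}" by blast
    with finite_elegant[OF lam] show ?thesis
      unfolding elegant_count_def card_eq_0_iff by blast
  qed
  ultimately show ?thesis by blast
qed

lemma var_power: "var k ^ n = Poly_Mapping.single (Poly_Mapping.single k n) 1"
  by (induction n) (simp_all add: var_def mult_single single_add[symmetric])

text \<open>Tableau monomials are single terms with coefficient 1; a coefficient of a Schur polynomial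
  is therefore a number of tableaux, and nothing can cancel.\<close>

lemma tableau_monomial_eq:
  "tableau_monomial D T =
     Poly_Mapping.single (\<Sum>k\<in>UNIV. Poly_Mapping.single k (tableau_content D T k)) 1"
proof -
  have "(\<Prod>k\<in>K. var k ^ tableau_content D T k) =
      Poly_Mapping.single (\<Sum>k\<in>K. Poly_Mapping.single k (tableau_content D T k)) (1 :: complex)"
    if "finite K" for K
    using that by induction (simp_all add: var_power mult_single)
  then show ?thesis by (simp add: tableau_monomial_def tableau_content_def)
qed

lemma lookup_sum_single:
  fixes f :: "'m::finite \<Rightarrow> nat"
  shows "Poly_Mapping.lookup (\<Sum>k\<in>UNIV. Poly_Mapping.single k (f k)) l = f l"
  by (simp add: lookup_sum lookup_single when_def)

definition kostka :: "(nat \<Rightarrow> nat) \<Rightarrow> ('m::linorder \<Rightarrow> nat) \<Rightarrow> nat" where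
  "kostka mu c = card {T. ssyt (diagram mu) T \<and> tableau_content (diagram mu) T = c}"

lemma lookup_schur:
  fixes \<alpha> :: "'m::{finite, linorder} \<Rightarrow>\<^sub>0 nat"
  assumes "partition_le n mu"
  shows "Poly_Mapping.lookup (schur mu) \<alpha> = of_nat (kostka mu (Poly_Mapping.lookup \<alpha>))"
proof -
  let ?D = "diagram mu"
  let ?C = "{T :: nat \<times> nat \<Rightarrow> 'm. ssyt ?D T}"
  have eq: "(\<Sum>k\<in>UNIV. Poly_Mapping.single k (tableau_content ?D T k)) = \<alpha> \<longleftrightarrow>
      tableau_content ?D T = Poly_Mapping.lookup \<alpha>" for T
    by (auto simp: poly_mapping_eq_iff fun_eq_iff lookup_sum_single)
  have "Poly_Mapping.lookup (schur mu) \<alpha> =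
      (\<Sum>T\<in>?C. if tableau_content ?D T = Poly_Mapping.lookup \<alpha> then 1 else 0)"
    by (simp add: schur_def lookup_sum tableau_monomial_eq lookup_single when_def eq)
  also have "\<dots> = of_nat (card {T \<in> ?C. tableau_content ?D T = Poly_Mapping.lookup \<alpha>})"
    using finite_schur_index[OF assms, where 'm = 'm]
    by (simp add: sum.If_cases Int_def)
  finally show ?thesis by (simp add: kostka_def)
qed

lemma lookup_of_nat_mult:
  "Poly_Mapping.lookup (of_nat n * f) \<alpha> = of_nat n * Poly_Mapping.lookup f \<alpha>"
  for f :: "'m cpoly"
  by (induction n) (simp_all add: distrib_right lookup_add)

lemma Supp_dual_grothendieck:
  fixes lam :: "nat \<Rightarrow> nat"
  assumes lam: "partition_le CARD('m::{finite, linorder}) lam"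
  shows "x \<in> Supp (dual_grothendieck lam :: 'm cpoly) \<longleftrightarrow>
    (\<exists>mu T. partition_le CARD('m) mu \<and> (\<forall>i. mu i \<le> lam i) \<and> mu 1 = lam 1 \<and>
       ssyt (diagram mu) T \<and> (\<forall>k. x $ k = real (tableau_content (diagram mu) T k)))"
proof -
  let ?M = "{mu. partition_le CARD('m) mu \<and> (\<forall>i. mu i \<le> lam i)}"
  have "Poly_Mapping.lookup (dual_grothendieck lam :: 'm cpoly) \<alpha> =
      of_nat (\<Sum>mu\<in>?M. elegant_count lam mu * kostka mu (Poly_Mapping.lookup \<alpha>))" for \<alpha>
    by (auto simp: dual_grothendieck_def lookup_sum lookup_of_nat_mult intro!: sum.cong lookup_schur)
  then have keys: "\<alpha> \<in> Poly_Mapping.keys (dual_grothendieck lam :: 'm cpoly) \<longleftrightarrow>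
      (\<exists>mu\<in>?M. elegant_count lam mu \<noteq> 0 \<and> kostka mu (Poly_Mapping.lookup \<alpha>) \<noteq> 0)" for \<alpha>
    using finite_subpartitions[OF lam] by (auto simp: in_keys_iff simp flip: of_nat_sum)
  have kostka: "kostka mu c \<noteq> 0 \<longleftrightarrow> (\<exists>T. ssyt (diagram mu) T \<and> tableau_content (diagram mu) T = c)"
    if "mu \<in> ?M" for mu and c :: "'m \<Rightarrow> nat"
  proof -
    have "finite {T :: nat \<times> nat \<Rightarrow> 'm. ssyt (diagram mu) T \<and> tableau_content (diagram mu) T = c}"
      using that by (intro finite_subset[OF _ finite_schur_index[of "CARD('m)" mu]]) auto
    then show ?thesis by (auto simp: kostka_def)
  qed
  have "\<alpha> \<in> Poly_Mapping.keys (dual_grothendieck lam :: 'm cpoly) \<longleftrightarrow>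
      (\<exists>mu T. mu \<in> ?M \<and> mu 1 = lam 1 \<and> ssyt (diagram mu) T \<and>
         tableau_content (diagram mu) T = Poly_Mapping.lookup \<alpha>)" for \<alpha>
    unfolding keys using elegant_count_pos_iff[OF lam] kostka by blast
  moreover have realized: "\<exists>\<alpha>. Poly_Mapping.lookup \<alpha> = tableau_content D T"
    for D and T :: "nat \<times> nat \<Rightarrow> 'm"
    by (rule exI[of _ "\<Sum>k\<in>UNIV. Poly_Mapping.single k (tableau_content D T k)"])
      (simp add: fun_eq_iff lookup_sum_single)
  ultimately have "x \<in> Supp (dual_grothendieck lam :: 'm cpoly) \<longleftrightarrow>
      (\<exists>mu T \<alpha>. mu \<in> ?M \<and> mu 1 = lam 1 \<and> ssyt (diagram mu) T \<and>
         tableau_content (diagram mu) T = Poly_Mapping.lookup \<alpha> \<and> x = exponent_vector \<alpha>)"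
    unfolding Supp_def by blast
  also have "\<dots> \<longleftrightarrow> (\<exists>mu T. mu \<in> ?M \<and> mu 1 = lam 1 \<and> ssyt (diagram mu) T \<and>
       (\<forall>k. x $ k = real (tableau_content (diagram mu) T k)))"
  proof -
    have "(\<exists>\<alpha>. tableau_content D T = Poly_Mapping.lookup \<alpha> \<and> x = exponent_vector \<alpha>) \<longleftrightarrow>
        (\<forall>k. x $ k = real (tableau_content D T k))" for D T
      using realized[of D T]
      by (auto simp: exponent_vector_def vec_eq_iff) metis
    then show ?thesis by blast
  qed
  finally show ?thesis by simp
qed

section \<open>The support as the lattice points of a generalized polymatroid\<close>

definition gpolymatroid :: "(nat \<Rightarrow> nat) \<Rightarrow> (real ^ 'm::finite) set" where
  "gpolymatroid lam = {x. (\<forall>k. 0 \<le> x $ k) \<and>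
     (\<forall>S. (\<Sum>k\<in>S. x $ k) \<le> real (top_rows lam (card S))) \<and> real (lam 1) \<le> (\<Sum>k\<in>UNIV. x $ k)}"

lemma convex_gpolymatroid: "convex (gpolymatroid lam)"
proof (rule convexI)
  fix x y :: "real ^ 'm" and u v :: real
  assume x: "x \<in> gpolymatroid lam" and y: "y \<in> gpolymatroid lam"
    and uv: "0 \<le> u" "0 \<le> v" "u + v = 1"
  have sum: "(\<Sum>k\<in>S. (u *\<^sub>R x + v *\<^sub>R y) $ k) = u * (\<Sum>k\<in>S. x $ k) + v * (\<Sum>k\<in>S. y $ k)" for S
    by (simp add: sum.distrib sum_distrib_left)
  have "u * a + v * b \<le> c" if "a \<le> c" "b \<le> c" for a b c
    using uv that convex_bound_le by blast
  moreover have "c \<le> u * a + v * b" if "c \<le> a" "c \<le> b" for a b c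
    using uv that convex_bound_le[of "-a" "-c" "-b" u v] by simp
  ultimately show "u *\<^sub>R x + v *\<^sub>R y \<in> gpolymatroid lam"
    using x y uv unfolding gpolymatroid_def mem_Collect_eq sum by simp
qed

text \<open>The inequalities are linear in \<open>lam\<close>, so dilating the polyhedron amounts to dilating the
  partition; lattice points of a dilate are again contents of tableaux.\<close>

lemma scaleR_gpolymatroid:
  assumes "x \<in> gpolymatroid lam"
  shows "real t *\<^sub>R x \<in> gpolymatroid (\<lambda>i. t * lam i)"
  using assms
  by (auto simp: gpolymatroid_def top_rows_def mult_left_mono simp flip: sum_distrib_left)

text \<open>Row \<open>i\<close> takes as many of the \<open>n\<close> boxes as fit into it once the rows above it are full;
  truncated subtraction leaves nothing for the rows that come too late.\<close>

definition greedy_shape :: "nat \<Rightarrow> (nat \<Rightarrow> nat) \<Rightarrow> nat \<Rightarrow> nat" where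
  "greedy_shape n lam i = min (lam i) (n - top_rows lam (i - 1))"

lemma top_rows_greedy_shape: "top_rows (greedy_shape n lam) k = min (top_rows lam k) n"
  by (induction k) (auto simp: greedy_shape_def)

lemma partition_le_greedy_shape:
  assumes "partition_le m lam"
  shows "partition_le m (greedy_shape n lam)"
proof -
  have "greedy_shape n lam j \<le> greedy_shape n lam i" if "1 \<le> i" "i \<le> j" for i j
  proof -
    have "top_rows lam (i - 1) \<le> top_rows lam (j - 1)" using that by (intro top_rows_mono) simp
    then show ?thesis
      unfolding greedy_shape_def
      by (intro min.mono partition_le_antimono[OF assms that] diff_le_mono2)
  qed
  then show ?thesis using assms by (auto simp: partition_le_def greedy_shape_def)
qed

lemma Supp_dual_grothendieck_eq_lattice_points:
  fixes lam :: "nat \<Rightarrow> nat"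
  assumes lam: "partition_le CARD('m::{finite, linorder}) lam"
  shows "Supp (dual_grothendieck lam :: 'm cpoly) = gpolymatroid lam \<inter> lattice_points"
proof (intro equalityI subsetI)
  fix x :: "(real, 'm) vec"
  assume "x \<in> Supp (dual_grothendieck lam)"
  then obtain mu and T :: "nat \<times> nat \<Rightarrow> 'm" where mu: "partition_le CARD('m) mu"
    and le: "\<And>i. mu i \<le> lam i" and eq: "mu 1 = lam 1" and T: "ssyt (diagram mu) T"
    and x: "\<And>k. x $ k = real (tableau_content (diagram mu) T k)"
    unfolding Supp_dual_grothendieck[OF lam] by blast
  have "(\<Sum>k\<in>S. x $ k) \<le> real (top_rows lam (card S))" for S
    using content_sum_le_top_rows[OF mu T, of S] top_rows_le[of mu lam "card S"] le
    by (simp add: x flip: of_nat_sum)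
  moreover have "lam 1 \<le> (\<Sum>k\<in>UNIV. tableau_content (diagram mu) T k)"
    using sum_content[where D = "diagram mu" and S = UNIV and T = T]
      finite_diagram[OF mu] card_diagram[OF mu] top_rows_mono[of 1 "CARD('m)" mu] eq
    by (simp add: Suc_le_eq)
  ultimately show "x \<in> gpolymatroid lam \<inter> lattice_points"
    by (simp add: gpolymatroid_def lattice_points_def x flip: of_nat_sum)
next
  fix x :: "(real, 'm) vec"
  assume x: "x \<in> gpolymatroid lam \<inter> lattice_points"
  define c where "c k = nat \<lfloor>x $ k\<rfloor>" for k
  have c: "x $ k = real (c k)" for k
  proof -
    have "0 \<le> x $ k" "x $ k \<in> \<int>" using x by (auto simp: gpolymatroid_def lattice_points_def)
    then show ?thesis by (auto simp: c_def elim!: Ints_cases)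
  qed
  have bound: "(\<Sum>k\<in>S. c k) \<le> top_rows lam (card S)" for S
    using x by (auto simp: gpolymatroid_def c simp flip: of_nat_sum)
  have total: "lam 1 \<le> (\<Sum>k\<in>UNIV. c k)"
    using x by (auto simp: gpolymatroid_def c simp flip: of_nat_sum)
  let ?n = "\<Sum>k\<in>UNIV. c k"
  define mu where "mu = greedy_shape ?n lam"
  have mu: "partition_le CARD('m) mu"
    using partition_le_greedy_shape[OF lam] by (simp add: mu_def)
  have "(\<Sum>k\<in>S. c k) \<le> top_rows mu (card S)" for S
    using bound[of S] sum_mono2[of UNIV S c] by (simp add: mu_def top_rows_greedy_shape)
  moreover have "?n = top_rows mu CARD('m)"
    using bound[of UNIV] by (simp add: mu_def top_rows_greedy_shape)
  ultimately obtain T where T: "ssyt (diagram mu) T" "\<And>k. tableau_content (diagram mu) T k = c k"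
    using ssyt_with_content[OF finite mu, where A = UNIV and c = c] by auto
  have "mu i \<le> lam i" "mu 1 = lam 1" for i
    using total by (auto simp: mu_def greedy_shape_def)
  then show "x \<in> Supp (dual_grothendieck lam)"
    unfolding Supp_dual_grothendieck[OF lam] using mu T c by metis
qed

lemma Newton_subset_gpolymatroid:
  assumes "partition_le CARD('m::{finite, linorder}) lam"
  shows "Newton (dual_grothendieck lam :: 'm cpoly) \<subseteq> gpolymatroid lam"
  unfolding Newton_def Supp_dual_grothendieck_eq_lattice_points[OF assms]
  by (intro hull_minimal convex_gpolymatroid) auto

section \<open>Splitting a tableau by its columns\<close>

text \<open>The columns congruent to \<open>k\<close> modulo \<open>t\<close>, where \<open>1 \<le> k \<le> t\<close>, are \<open>k, t + k, 2t + k, \<dots>\<close>,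
  and the quotient counts those among the first \<open>nu i\<close> columns. They are renumbered
  \<open>1, 2, \<dots>\<close>, and \<open>class_box\<close> undoes the renumbering.\<close>

definition class_shape :: "nat \<Rightarrow> nat \<Rightarrow> (nat \<Rightarrow> nat) \<Rightarrow> nat \<Rightarrow> nat" where
  "class_shape t k nu i = (nu i + t - k) div t"

definition class_box :: "nat \<Rightarrow> nat \<Rightarrow> nat \<times> nat \<Rightarrow> nat \<times> nat" where
  "class_box t k = (\<lambda>(i, j). (i, (j - 1) * t + k))"

lemma class_box_in_diagram:
  assumes "k \<in> {1..t}" "1 \<le> j"
  shows "class_box t k (i, j) \<in> diagram nu \<longleftrightarrow> (i, j) \<in> diagram (class_shape t k nu)"
proof -
  have "j \<le> (nu i + t - k) div t \<longleftrightarrow> j * t \<le> nu i + t - k"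
    using assms by (intro less_eq_div_iff_mult_less_eq) auto
  also have "\<dots> \<longleftrightarrow> (j - 1) * t + k \<le> nu i"
    using assms by (cases j) (auto simp: algebra_simps)
  finally show ?thesis using assms by (auto simp: mem_diagram class_shape_def class_box_def)
qed

lemma partition_le_class_shape:
  assumes "partition_le m nu" "k \<in> {1..t}"
  shows "partition_le m (class_shape t k nu)"
  using assms by (auto simp: partition_le_def class_shape_def intro!: div_le_mono diff_le_mono)

lemma ssyt_class:
  assumes T: "ssyt (diagram nu) T" and k: "k \<in> {1..t}"
  shows "ssyt (diagram (class_shape t k nu))
           (restrict (T \<circ> class_box t k) (diagram (class_shape t k nu)))"
proof -
  let ?D = "diagram (class_shape t k nu)"
  have D: "class_box t k (i, j) \<in> diagram nu" if "(i, j) \<in> ?D" for i j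
    using that class_box_in_diagram[OF k] by (simp add: mem_diagram)
  have mono: "(j - 1) * t + k < (j' - 1) * t + k" if "1 \<le> j" "j < j'" for j j'
    using that k by auto
  have row: "T (class_box t k (i, j)) \<le> T (class_box t k (i, j'))"
    if "(i, j) \<in> ?D" "(i, j') \<in> ?D" "j < j'" for i j j'
  proof -
    have "(j - 1) * t + k < (j' - 1) * t + k"
      using that by (intro mono) (auto simp: mem_diagram)
    then show ?thesis
      using T D[OF that(1)] D[OF that(2)] unfolding ssyt_def class_box_def prod.case by blast
  qed
  have col: "T (class_box t k (i, j)) < T (class_box t k (i', j))"
    if "(i, j) \<in> ?D" "(i', j) \<in> ?D" "i < i'" for i i' j
    using T D[OF that(1)] D[OF that(2)] that unfolding ssyt_def class_box_def prod.case by blast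
  show ?thesis
    unfolding ssyt_def by (intro conjI allI impI; (elim conjE)?; simp add: row col)
qed

text \<open>Every column belongs to exactly one class: column \<open>j\<close> is number \<open>(j - 1) div t + 1\<close> of class
  \<open>(j - 1) mod t + 1\<close>.\<close>

lemma sum_content_classes:
  assumes nu: "partition_le m nu" and t: "1 \<le> t"
  shows "(\<Sum>k=1..t. tableau_content (diagram (class_shape t k nu))
            (restrict (T \<circ> class_box t k) (diagram (class_shape t k nu))) e) =
         tableau_content (diagram nu) T e"
proof -
  define B where "B k = {b \<in> diagram (class_shape t k nu). T (class_box t k b) = e}" for k
  have fin: "finite (B k)" if "k \<in> {1..t}" for k
    using finite_diagram[OF partition_le_class_shape[OF nu that]] by (simp add: B_def)
  have "(\<Sum>k=1..t. tableau_content (diagram (class_shape t k nu))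
      (restrict (T \<circ> class_box t k) (diagram (class_shape t k nu))) e) = (\<Sum>k=1..t. card (B k))"
    unfolding tableau_content_def B_def by (intro sum.cong refl arg_cong[of _ _ card]) auto
  also have "\<dots> = card (SIGMA k:{1..t}. B k)" using fin by simp
  also have "\<dots> = card {b \<in> diagram nu. T b = e}"
  proof (rule bij_betw_same_card[of "\<lambda>(k, b). class_box t k b"],
      rule bij_betw_byWitness[of _ "\<lambda>(i, j). (((j - 1) mod t + 1), (i, (j - 1) div t + 1))"])
    have inv: "class_box t ((j - 1) mod t + 1) (i, (j - 1) div t + 1) = (i, j)" if "1 \<le> j" for i j
      using that by (simp add: class_box_def)
    have cls: "(j - 1) mod t + 1 \<in> {1..t}" for j
      using t by (simp add: Suc_le_eq)
    show "\<forall>a\<in>SIGMA k:{1..t}. B k. (case case a of (k, b) \<Rightarrow> class_box t k b of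
        (i, j) \<Rightarrow> ((j - 1) mod t + 1, i, (j - 1) div t + 1)) = a"
    proof clarsimp
      fix k i j assume "Suc 0 \<le> k" "k \<le> t" "(i, j) \<in> B k"
      then obtain k' j' where "k = Suc k'" "j = Suc j'" "k' < t"
        by (cases k; cases j) (auto simp: B_def mem_diagram)
      then show "(case class_box t k (i, j) of
          (i, j) \<Rightarrow> (Suc ((j - Suc 0) mod t), i, Suc ((j - Suc 0) div t))) = (k, i, j)"
        by (simp add: class_box_def)
    qed
    show "\<forall>a\<in>{b \<in> diagram nu. T b = e}. (case case a of
        (i, j) \<Rightarrow> ((j - 1) mod t + 1, i, (j - 1) div t + 1) of (k, b) \<Rightarrow> class_box t k b) = a"
      using inv by (auto simp: mem_diagram)
    show "(\<lambda>(k, b). class_box t k b) ` (SIGMA k:{1..t}. B k) \<subseteq> {b \<in> diagram nu. T b = e}"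
      using class_box_in_diagram by (fastforce simp: B_def mem_diagram)
    show "(\<lambda>(i, j). ((j - 1) mod t + 1, i, (j - 1) div t + 1)) ` {b \<in> diagram nu. T b = e}
        \<subseteq> (SIGMA k:{1..t}. B k)"
    proof clarify
      fix i j assume b: "(i, j) \<in> diagram nu" "e = T (i, j)"
      then have "1 \<le> j" by (simp add: mem_diagram)
      then show "(j - 1) mod t + 1 \<in> {1..t} \<and> (i, (j - 1) div t + 1) \<in> B ((j - 1) mod t + 1)"
        using b inv[of j i] cls class_box_in_diagram[OF cls, of "(j - 1) div t + 1" j i nu]
        by (simp add: B_def)
    qed
  qed
  finally show ?thesis by (simp add: tableau_content_def)
qed

text \<open>Each class gets its full share of a row whose length is a multiple of \<open>t\<close>. The second claim,
  applied to the first row, is what keeps all pieces of a tableau admissible for \<open>g\<^sub>\<lambda>\<close>.\<close>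

lemma class_shape_bounds:
  assumes "k \<in> {1..t}"
  shows "nu i \<le> t * lam i \<Longrightarrow> class_shape t k nu i \<le> lam i"
    and "nu i = t * lam i \<Longrightarrow> class_shape t k nu i = lam i"
proof -
  have "t * lam i + t - k = (t - k) + t * lam i" using assms by auto
  moreover have "t \<noteq> 0" "(t - k) div t = 0" using assms by (auto intro: div_less)
  ultimately have eq: "(t * lam i + t - k) div t = lam i"
    using div_mult_self2[of t "t - k" "lam i"] by presburger
  show "nu i = t * lam i \<Longrightarrow> class_shape t k nu i = lam i" by (simp add: class_shape_def eq)
  assume "nu i \<le> t * lam i"
  then have "(nu i + t - k) div t \<le> (t * lam i + t - k) div t"
    by (intro div_le_mono diff_le_mono) simp
  then show "class_shape t k nu i \<le> lam i" by (simp add: class_shape_def eq)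
qed

lemma lattice_point_decomposition:
  fixes p :: "real ^ 'm::{finite, linorder}"
  assumes lam: "partition_le CARD('m) lam" and t: "1 \<le> t"
    and p: "p \<in> gpolymatroid (\<lambda>i. t * lam i)" "p \<in> lattice_points"
  shows "\<exists>v. (\<forall>k\<in>{1..t}. v k \<in> Supp (dual_grothendieck lam :: 'm cpoly)) \<and> p = (\<Sum>k=1..t. v k)"
proof -
  have tlam: "partition_le CARD('m) (\<lambda>i. t * lam i)"
    using lam by (auto simp: partition_le_def)
  have "p \<in> Supp (dual_grothendieck (\<lambda>i. t * lam i) :: 'm cpoly)"
    using p unfolding Supp_dual_grothendieck_eq_lattice_points[OF tlam] by blast
  then obtain nu and T :: "nat \<times> nat \<Rightarrow> 'm" where nu: "partition_le CARD('m) nu"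
    and le: "\<And>i. nu i \<le> t * lam i" and eq: "nu 1 = t * lam 1" and T: "ssyt (diagram nu) T"
    and content: "\<And>e. p $ e = real (tableau_content (diagram nu) T e)"
    unfolding Supp_dual_grothendieck[OF tlam] by blast
  define D where "D k = diagram (class_shape t k nu)" for k
  define U where "U k = restrict (T \<circ> class_box t k) (D k)" for k
  define v :: "nat \<Rightarrow> (real, 'm) vec" where "v k = (\<chi> e. real (tableau_content (D k) (U k) e))" for k
  have "v k \<in> Supp (dual_grothendieck lam :: 'm cpoly)" if k: "k \<in> {1..t}" for k
    unfolding Supp_dual_grothendieck[OF lam]
  proof (intro exI[of _ "class_shape t k nu"] exI[of _ "U k"] conjI allI)
    show "partition_le CARD('m) (class_shape t k nu)" by (rule partition_le_class_shape[OF nu k])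
    show "class_shape t k nu i \<le> lam i" for i
      by (rule class_shape_bounds(1)[where nu = nu and lam = lam and i = i, OF k le])
    show "class_shape t k nu 1 = lam 1"
      by (rule class_shape_bounds(2)[where nu = nu and lam = lam and i = 1, OF k eq])
    show "ssyt (diagram (class_shape t k nu)) (U k)"
      using ssyt_class[OF T k] by (simp add: U_def D_def)
    show "v k $ e = real (tableau_content (diagram (class_shape t k nu)) (U k) e)" for e
      by (simp add: v_def D_def)
  qed
  moreover have "p = (\<Sum>k=1..t. v k)"
    using sum_content_classes[OF nu t, of T]
    by (simp add: vec_eq_iff v_def U_def D_def content flip: of_nat_sum)
  ultimately show ?thesis by blast
qed

theorem mainTheorem3:
  fixes lam :: "nat \<Rightarrow> nat"
  assumes "partition_le CARD('m::{finite, linorder}) lam"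
  shows "has_SNP (dual_grothendieck lam :: 'm cpoly) \<and>
         has_IDP (Newton (dual_grothendieck lam :: 'm cpoly))"
proof
  let ?g = "dual_grothendieck lam :: 'm cpoly"
  note Supp = Supp_dual_grothendieck_eq_lattice_points[OF assms]
  have Supp_sub: "Supp ?g \<subseteq> Newton ?g" unfolding Newton_def by (rule hull_subset)
  show SNP: "has_SNP ?g"
    using Newton_subset_gpolymatroid[OF assms] Supp_sub Supp unfolding has_SNP_def by blast
  have "polytope (Newton ?g)"
    unfolding Newton_def polytope_def Supp_def using finite_imageI[OF finite_keys] by blast
  moreover have "v \<in> lattice_points" if "v extreme_point_of Newton ?g" for v
    using extreme_point_of_convex_hull[of v "Supp ?g"] that Supp unfolding Newton_def by blast
  moreover have "\<exists>v. (\<forall>k\<in>{1..t}. v k \<in> Newton ?g \<inter> lattice_points) \<and> p = (\<Sum>k=1..t. v k)"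
    if "1 \<le> t" "p \<in> (\<lambda>v. real t *\<^sub>R v) ` Newton ?g \<inter> lattice_points" for t p
  proof -
    have "p \<in> gpolymatroid (\<lambda>i. t * lam i)"
      using that Newton_subset_gpolymatroid[OF assms] scaleR_gpolymatroid by blast
    moreover have "p \<in> lattice_points" using that by blast
    ultimately obtain v where "\<forall>k\<in>{1..t}. v k \<in> Supp ?g" "p = (\<Sum>k=1..t. v k)"
      using lattice_point_decomposition[OF assms \<open>1 \<le> t\<close>] by blast
    moreover have "Supp ?g = Newton ?g \<inter> lattice_points" using SNP by (simp add: has_SNP_def)
    ultimately show ?thesis by (intro exI[of _ v]) simp
  qed
  ultimately show "has_IDP (Newton ?g)"
    unfolding has_IDP_def lattice_polytope_def by blast
qed

end
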